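(* Fix $x\in(0,1)$. For $m,n\in\mathbb{C}$ with $\Re m>-1$ and $\Re n>-1$ put $$ p_{m,n}(x):=\frac{\Gamma(m+n+2)}{\Gamma(m+1)\Gamma(n+1)}\,B_{1-x}(n+1,m+1),\qquad q_{m,n}(x):=p_{n,m}(1-x). $$ Then $$ p_{m,n}(x)+q_{m,n}(x)=1\qquad(m,n\in\mathbb{C},\ \Re m,\Re n>-1). $$ Moreover, $(p_{m,n}(x),q_{m,n}(x))$ is the unique pair of functions of $(m,n)\in\{\Re m>-1\}\times\{\Re n>-1\}$ with the following properties: (i) $p_{m,n}(x)+q_{m,n}(x)=1$ for all $m,n\in\mathbb{C}$ with $\Re m,\Re n>-1$; (ii) for nonnegative integers $m,n$, $$ p_{m,n}(x)=(1-x)^{n+1}\sum_{k=0}^m\frac{(n+1)_k}{k!}x^k,\qquad q_{m,n}(x)=x^{m+1}\sum_{k=0}^n\frac{(m+1)_k}{k!}(1-x)^k; $$ (iii) $p_{m,n}(x)$ and $q_{m,n}(x)$ are analytic in $m,n$ for $\Re m,\Re n>-1$; (iv) for some $c\in(0,\pi)$, the functions $p_{m,n}(x)$ and $q_{m,n}(x)$ are $O(e^{c|n|})$ in the half-plane $\Re n\ge0$ for each fixed $m$ with $\Re m>-1$, and are $O(e^{c|m|})$ in the half-plane $\Re m\ge0$ for each fixed $n$ with $\Re n>-1$.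
   Context: $(a)_k$ is the Pochhammer symbol: $(a)_0=1$ and $(a)_k=a(a+1)\cdots(a+k-1)$ for $k\ge1$. The incomplete beta function is $B_y(\mu+1,\nu+1):=\int_0^y t^{\mu}(1-t)^{\nu}\,dt$ for $y\in(0,1)$, $\mu,\nu\in\mathbb{C}$, $\Re\mu>-1$. The implied constants in the $O$-estimates may depend on $x$ and on the fixed variable. *)

theory Defs
  imports "HOL-Analysis.Analysis" "HOL-Library.Landau_Symbols"
begin

(* The base is a positive real inside the interval, so powr is the principal power
   exp ((a - 1) * ln t); the endpoint t = 0 (where 0 powr _ = 0) has measure zero. *)
definition incomplete_beta :: "real \<Rightarrow> complex \<Rightarrow> complex \<Rightarrow> complex" where
  "incomplete_beta y a b =
     integral {0..y} (\<lambda>t. of_real t powr (a - 1) * of_real (1 - t) powr (b - 1))"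

definition p_fun :: "real \<Rightarrow> complex \<Rightarrow> complex \<Rightarrow> complex" where
  "p_fun x m n = Gamma (m + n + 2) / (Gamma (m + 1) * Gamma (n + 1))
                   * incomplete_beta (1 - x) (n + 1) (m + 1)"

definition q_fun :: "real \<Rightarrow> complex \<Rightarrow> complex \<Rightarrow> complex" where
  "q_fun x m n = p_fun (1 - x) n m"

(* Joint analyticity in two complex variables, the analogue of analytic_on:
   on an open neighbourhood of S there is a complex-linear total derivative at every point. *)
definition analytic2_on :: "(complex \<times> complex \<Rightarrow> complex) \<Rightarrow> (complex \<times> complex) set \<Rightarrow> bool" where
  "analytic2_on f S \<longleftrightarrow> (\<exists>U. open U \<and> S \<subseteq> U \<and>
     (\<forall>z\<in>U. \<exists>a b. (f has_derivative (\<lambda>(h, k). a * h + b * k)) (at z)))"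

definition right_half_plane :: "complex set" where
  "right_half_plane = {z. Re z > -1}"

(* The estimates hold throughout the closed half-plane Re z \<ge> 0, hence the principal filter:
   f is in O[principal S](g) iff there is C > 0 with norm (f z) \<le> C * norm (g z) on all of S. *)
definition exp_bounded :: "real \<Rightarrow> (complex \<Rightarrow> complex) \<Rightarrow> bool" where
  "exp_bounded c f \<longleftrightarrow>
     f \<in> O[principal {z. Re z \<ge> 0}](\<lambda>z. of_real (exp (c * norm z)))"

definition pq_properties ::
  "real \<Rightarrow> (complex \<Rightarrow> complex \<Rightarrow> complex) \<Rightarrow> (complex \<Rightarrow> complex \<Rightarrow> complex) \<Rightarrow> bool" where
  "pq_properties x P Q \<longleftrightarrow>
     (\<forall>m\<in>right_half_plane. \<forall>n\<in>right_half_plane. P m n + Q m n = 1) \<and>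
     (\<forall>m n :: nat.
        P (of_nat m) (of_nat n) =
          of_real ((1 - x) ^ (n + 1) * (\<Sum>k=0..m. pochhammer (of_nat n + 1) k / fact k * x ^ k)) \<and>
        Q (of_nat m) (of_nat n) =
          of_real (x ^ (m + 1) * (\<Sum>k=0..n. pochhammer (of_nat m + 1) k / fact k * (1 - x) ^ k))) \<and>
     analytic2_on (\<lambda>(m, n). P m n) (right_half_plane \<times> right_half_plane) \<and>
     analytic2_on (\<lambda>(m, n). Q m n) (right_half_plane \<times> right_half_plane) \<and>
     (\<exists>c\<in>{0<..<pi}.
        (\<forall>m\<in>right_half_plane. exp_bounded c (\<lambda>n. P m n) \<and> exp_bounded c (\<lambda>n. Q m n)) \<and>
        (\<forall>n\<in>right_half_plane. exp_bounded c (\<lambda>m. P m n) \<and> exp_bounded c (\<lambda>m. Q m n)))"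

end

theory Submission
  imports Defs "HOL-Complex_Analysis.Complex_Analysis"
begin

text \<open>
  Existence. The substitution \<open>t \<mapsto> 1 - t\<close> turns the two incomplete beta integrals in \<open>p + q\<close> into
  the two pieces of one complete beta integral, whose value \<open>\<Gamma>(a) \<Gamma>(b) / \<Gamma>(a + b)\<close> cancels the
  prefactor. For complex exponents that value comes from the real one by the identity theorem, applied
  in each variable in turn (\<open>incomplete_beta_1\<close>, \<open>incomplete_beta_reflection\<close>). Joint analyticity
  is differentiation under the integral sign: all error terms are dominated by real beta integrands
  with slightly smaller exponents (\<open>complex_differentiable2_integral_beta_kernel\<close>). At nonnegative
  integers the finite sum is an explicit antiderivative of the integrand
  (\<open>has_field_derivative_p_poly\<close>). For growth, the integral stays bounded, and the quotient of Gamma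
  functions in front of it grows at most polynomially, since up to a constant it is a Pochhammer
  polynomial times a bounded beta integral (\<open>exp_bounded_Gamma_ratio\<close>); so every \<open>c > 0\<close> is
  admissible, and \<open>c = 1\<close> is used.

  Uniqueness. Two solutions agree at all pairs of nonnegative integers. Carlson's theorem
  says that a holomorphic function on the right half-plane of exponential type less than \<open>\<pi>\<close>
  that vanishes at the positive integers is zero. It is applied in \<open>n\<close> for each fixed integer \<open>m\<close>,
  and then in \<open>m\<close> for each fixed complex \<open>n\<close> (\<open>pq_properties_unique\<close>).

  Carlson's theorem is proved through the quotient of \<open>f\<close> by \<open>sin (\<pi> z)\<close>. It is holomorphic, and
  away from the integers it is at most \<open>C exp (c Re z - \<delta> \<bar>Im z\<bar>)\<close>. The decay in the imaginary
  direction pays for a damping factor like \<open>exp (- \<epsilon> z Ln z)\<close>, which in the real direction beats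
  every exponential \<open>exp (B Re z)\<close>. By the maximum principle the quotient is then
  \<open>O(exp (- B Re z))\<close> for all \<open>B\<close> at once, and so it vanishes.
\<close>

section \<open>Carlson's theorem\<close>

text \<open>
  At a common zero \<open>a\<close> both functions are divided by \<open>z - a\<close>; simplicity of the zero of \<open>s\<close> makes the
  new denominator nonzero at \<open>a\<close>, where its value is \<open>deriv s a\<close>. The value of \<open>g\<close> at \<open>a\<close> is then
  the one given by l'Hospital's rule.
\<close>

lemma holomorphic_quotient_simple_zeros:
  fixes f s :: "complex \<Rightarrow> complex"
  assumes f: "f holomorphic_on S" and s: "s holomorphic_on S" and S: "open S"
    and zero: "\<And>z. z \<in> S \<Longrightarrow> s z = 0 \<Longrightarrow> f z = 0 \<and> deriv s z \<noteq> 0"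
  obtains g where "g holomorphic_on S" "\<And>z. z \<in> S \<Longrightarrow> f z = g z * s z"
proof
  define g where "g z = (if s z = 0 then deriv f z / deriv s z else f z / s z)" for z
  show "f z = g z * s z" if "z \<in> S" for z
    using zero[OF that] by (simp add: g_def)
  have "g field_differentiable (at a)" if a: "a \<in> S" for a
  proof -
    define F1 where "F1 z = (if z = a then deriv f a else (f z - f a) / (z - a))" for z
    define S1 where "S1 z = (if z = a then deriv s a else (s z - s a) / (z - a))" for z
    have F1: "F1 holomorphic_on S" and S1: "S1 holomorphic_on S"
      unfolding F1_def S1_def using f s S by (auto intro!: pole_lemma_open)
    show ?thesis
    proof (cases "s a = 0")
      case True
      define N where "N = {z \<in> S. S1 z \<noteq> 0}"
      have N: "open N"
      proof -
        have "N = S \<inter> S1 -` (- {0})" by (auto simp: N_def)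
        thus ?thesis using S1 S
          by (auto intro!: continuous_open_preimage holomorphic_on_imp_continuous_on)
      qed
      have aN: "a \<in> N" using True zero[OF a] a by (simp add: N_def S1_def)
      have "(\<lambda>z. F1 z / S1 z) holomorphic_on N"
        using F1 S1 by (auto intro!: holomorphic_intros intro: holomorphic_on_subset simp: N_def)
      moreover have "F1 z / S1 z = g z" if "z \<in> N" for z
        using that True zero[OF a]
        by (cases "z = a") (auto simp: N_def F1_def S1_def g_def)
      ultimately have "g holomorphic_on N" by (rule holomorphic_transform)
      thus ?thesis using N aN holomorphic_on_imp_differentiable_at by blast
    next
      case False
      define N where "N = {z \<in> S. s z \<noteq> 0}"
      have N: "open N"
      proof -
        have "N = S \<inter> s -` (- {0})" by (auto simp: N_def)
        thus ?thesis using s S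
          by (auto intro!: continuous_open_preimage holomorphic_on_imp_continuous_on)
      qed
      have aN: "a \<in> N" using False a by (simp add: N_def)
      have "(\<lambda>z. f z / s z) holomorphic_on N"
        using f s by (auto intro!: holomorphic_intros intro: holomorphic_on_subset simp: N_def)
      hence "g holomorphic_on N"
        by (rule holomorphic_transform) (auto simp: N_def g_def)
      thus ?thesis using N aN holomorphic_on_imp_differentiable_at by blast
    qed
  qed
  thus "g holomorphic_on S"
    by (auto simp: holomorphic_on_def intro: field_differentiable_at_within)
qed

text \<open>
  The bound is needed only on lines that avoid the integers, because rectangles bounded by such lines
  exhaust the half-plane \<open>Re z \<ge> 1/2\<close> and the maximum principle carries bounds to their interior. The
  auxiliary function is \<open>H z = g z * exp (B (z - 1/2) - \<epsilon> (z + 1) Ln (z + 1))\<close>. As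
  \<open>Re ((z + 1) Ln (z + 1)) = (Re z + 1) ln \<bar>z + 1\<bar> - Im z * Arg (z + 1)\<close>, the angular part is absorbed by
  the decay of \<open>g\<close>, and the logarithmic part eventually wins against \<open>c + B\<close>. On the line
  \<open>Re z = 1/2\<close> the factor with \<open>B\<close> has modulus 1, so the bound for \<open>H\<close> does not depend on \<open>B\<close>.
  The shift to \<open>z + 1\<close> makes \<open>ln \<bar>z + 1\<bar>\<close> nonnegative on the whole half-plane.
\<close>

lemma zero_of_exponential_decay_on_grid:
  fixes g :: "complex \<Rightarrow> complex"
  assumes g: "g holomorphic_on {z. Re z > 0}"
    and "c \<ge> 0" "\<delta> > 0" "C \<ge> 0"
    and bound: "\<And>z. Re z \<ge> 1/2 \<Longrightarrow> (\<exists>k::nat. Re z = of_nat k + 1/2) \<or> \<bar>Im z\<bar> \<ge> 1 \<Longrightarrow>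
                  norm (g z) \<le> C * exp (c * Re z - \<delta> * \<bar>Im z\<bar>)"
    and w: "Re w > 1/2"
  shows "g w = 0"
proof (rule ccontr)
  assume nz: "g w \<noteq> 0"
  \<comment> \<open>The argument of \<open>z + 1\<close> is at most 2 in modulus, so \<open>2 * \<epsilon> \<le> \<delta>\<close> suffices.\<close>
  define \<epsilon> where "\<epsilon> = \<delta> / 2"
  define D where "D z = (z + 1) * Ln (z + 1)" for z :: complex
  define C1 where "C1 = C * exp (c / 2)"
  define K where "K = exp (\<epsilon> * Re (D w))"
  have \<epsilon>: "\<epsilon> > 0" using \<open>\<delta> > 0\<close> by (simp add: \<epsilon>_def)
  have C1: "C1 \<ge> 0" using \<open>C \<ge> 0\<close> by (simp add: C1_def)
  have D: "Re (D z) \<ge> (Re z + 1) * ln (norm (z + 1)) - 2 * \<bar>Im z\<bar>" if "Re z > 0" for z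
  proof -
    have "\<bar>Im (Ln (z + 1))\<bar> < pi / 2"
      using that by (intro Re_Ln_pos_lt_imp) auto
    hence "\<bar>Im (Ln (z + 1))\<bar> \<le> 2" using pi_less_4 by linarith
    hence "\<bar>Im z\<bar> * \<bar>Im (Ln (z + 1))\<bar> \<le> \<bar>Im z\<bar> * 2" by (intro mult_left_mono) auto
    hence "Im z * Im (Ln (z + 1)) \<le> 2 * \<bar>Im z\<bar>" 
      by (metis abs_ge_self abs_mult mult.commute order_trans)
    moreover have "z + 1 \<noteq> 0" using that by (auto simp: complex_eq_iff)
    ultimately show ?thesis by (simp add: D_def)
  qed
  have main: "norm (g w) * exp (B * (Re w - 1/2)) \<le> C1 * K" if "B \<ge> 0" for B
  proof -
    define H where "H z = g z * exp (of_real B * (z - 1/2) - of_real \<epsilon> * D z)" for z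
    \<comment> \<open>Beyond this radius \<open>\<epsilon> * ln \<bar>z + 1\<bar> \<ge> c + B\<close>.\<close>
    define R where "R = exp ((c + B) / \<epsilon>) + norm w + 1"
    obtain N :: nat where N: "real N \<ge> R" using real_arch_simple by blast
    define p where "p = Complex (1/2) (- real N)"
    define q where "q = Complex (real N + 1/2) (real N)"
    have R: "R > norm w" "R \<ge> 1" "ln R \<ge> (c + B) / \<epsilon>"
    proof -
      show "R > norm w" by (simp add: R_def add_pos_nonneg)
      show "R \<ge> 1" by (simp add: R_def)
      have "ln R \<ge> ln (exp ((c + B) / \<epsilon>))"
        using \<open>R \<ge> 1\<close> by (intro ln_mono) (auto simp: R_def)
      thus "ln R \<ge> (c + B) / \<epsilon>" by simp
    qed
    have H: "norm (H z) \<le> C1" if z: "Re z \<ge> 1/2" 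
      "(\<exists>k::nat. Re z = of_nat k + 1/2) \<or> \<bar>Im z\<bar> \<ge> 1" "Re z = 1/2 \<or> norm (z + 1) \<ge> R" for z
    proof -
      have "norm (z + 1) \<ge> Re (z + 1)" by (rule complex_Re_le_cmod)
      hence n1: "norm (z + 1) \<ge> 1" using z by simp
      have "\<epsilon> * Re (D z) \<ge> \<epsilon> * ((Re z + 1) * ln (norm (z + 1)) - 2 * \<bar>Im z\<bar>)"
        using z \<epsilon> by (intro mult_left_mono D) auto
      hence D': "\<epsilon> * Re (D z) \<ge> \<epsilon> * (Re z + 1) * ln (norm (z + 1)) - \<delta> * \<bar>Im z\<bar>"
        by (simp add: \<epsilon>_def algebra_simps)
      have le: "c * Re z + B * (Re z - 1/2) - \<epsilon> * (Re z + 1) * ln (norm (z + 1)) \<le> c / 2"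
        using z(3)
      proof
        assume "Re z = 1/2"
        moreover have "\<epsilon> * (Re z + 1) * ln (norm (z + 1)) \<ge> 0"
          using \<epsilon> n1 z by (intro mult_nonneg_nonneg) auto
        ultimately show ?thesis by (simp only:) simp
      next
        assume "norm (z + 1) \<ge> R"
        hence "ln (norm (z + 1)) \<ge> ln R" using R by (subst ln_le_cancel_iff) auto
        hence "ln (norm (z + 1)) \<ge> (c + B) / \<epsilon>" using R by linarith
        hence "\<epsilon> * (Re z + 1) * ln (norm (z + 1)) \<ge> \<epsilon> * (Re z + 1) * ((c + B) / \<epsilon>)"
          using \<epsilon> z by (intro mult_left_mono) auto
        also have "\<epsilon> * (Re z + 1) * ((c + B) / \<epsilon>) = (Re z + 1) * (c + B)"
          using \<epsilon> by simp
        finally show ?thesis using \<open>c \<ge> 0\<close> \<open>B \<ge> 0\<close> by (simp add: algebra_simps)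
      qed
      have "norm (H z) = norm (g z) * exp (B * (Re z - 1/2) - \<epsilon> * Re (D z))"
        by (simp add: H_def norm_mult)
      also have "\<dots> \<le> (C * exp (c * Re z - \<delta> * \<bar>Im z\<bar>)) * exp (B * (Re z - 1/2) - \<epsilon> * Re (D z))"
        using bound[OF z(1,2)] by (rule mult_right_mono) auto
      also have "\<dots> = C * exp (c * Re z - \<delta> * \<bar>Im z\<bar> + (B * (Re z - 1/2) - \<epsilon> * Re (D z)))"
        by (simp add: exp_add)
      also have "\<dots> \<le> C * exp (c / 2)"
        using D' le \<open>C \<ge> 0\<close> by (intro mult_left_mono) auto
      finally show ?thesis by (simp add: C1_def)
    qed
    have Hhol: "H holomorphic_on {z. Re z > 0}"
    proof -
      have "Re z > 0 \<Longrightarrow> z + 1 \<notin> \<real>\<^sub>\<le>\<^sub>0" for z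
        by (auto simp: complex_nonpos_Reals_iff)
      thus ?thesis unfolding H_def D_def by (intro holomorphic_intros g) auto
    qed
    have sub: "cbox p q \<subseteq> {z. Re z > 0}" by (auto simp: p_def in_cbox_complex_iff)
    have "norm (H w) \<le> C1"
    proof (rule maximum_modulus_frontier[where S = "cbox p q" and f = H and \<xi> = w])
      show "H holomorphic_on interior (cbox p q)"
        using sub interior_subset by (intro holomorphic_on_subset[OF Hhol]) blast
      show "continuous_on (closure (cbox p q)) H"
        using holomorphic_on_imp_continuous_on[OF holomorphic_on_subset[OF Hhol sub]] by simp
      show "norm (H z) \<le> C1" if "z \<in> frontier (cbox p q)" for z
      proof -
        have fr: "z \<in> cbox p q" "z \<notin> box p q"
          using that by (auto simp: frontier_cbox)
        hence z: "1/2 \<le> Re z" "Re z \<le> real N + 1/2" "\<bar>Im z\<bar> \<le> real N"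
          by (auto simp: p_def q_def in_cbox_complex_iff)
        from fr z consider "Re z = of_nat 0 + 1/2" | "Re z = real N + 1/2" | "\<bar>Im z\<bar> = real N"
          by (force simp: p_def q_def in_box_complex_iff)
        thus ?thesis
        proof cases
          case 1
          thus ?thesis using z by (intro H) (auto intro: exI[of _ "0::nat"])
        next
          case 2
          have "norm (z + 1) \<ge> Re (z + 1)" by (rule complex_Re_le_cmod)
          thus ?thesis using z 2 N by (intro H) auto
        next
          case 3
          have "norm (z + 1) \<ge> \<bar>Im (z + 1)\<bar>" by (rule abs_Im_le_cmod)
          thus ?thesis using z 3 N R by (intro H) auto
        qed
      qed
      have "\<bar>Re w\<bar> \<le> R" "\<bar>Im w\<bar> \<le> R"
        using abs_Re_le_cmod[of w] abs_Im_le_cmod[of w] R by linarith+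
      thus "w \<in> cbox p q" using w N by (auto simp: p_def q_def in_cbox_complex_iff)
    qed auto
    moreover have "norm (H w) = norm (g w) * exp (B * (Re w - 1/2)) / K"
      by (simp add: H_def K_def norm_mult norm_divide exp_diff)
    ultimately show ?thesis by (simp add: K_def divide_simps)
  qed
  \<comment> \<open>Chosen such that \<open>C1 * K = norm (g w) * x\<close> for \<open>x = B * (Re w - 1/2)\<close>, while \<open>x < exp x\<close>.\<close>
  define B where "B = (C1 * K / norm (g w)) / (Re w - 1/2)"
  have "B \<ge> 0" using C1 w by (simp add: B_def K_def)
  have "C1 * K = norm (g w) * (B * (Re w - 1/2))"
    using nz w by (simp add: B_def)
  also have "\<dots> < norm (g w) * exp (B * (Re w - 1/2))"
  proof (intro mult_strict_left_mono)
    show "B * (Re w - 1/2) < exp (B * (Re w - 1/2))"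
      using exp_ge_add_one_self[of "B * (Re w - 1/2)"] by linarith
  qed (use nz in auto)
  finally show False using main[OF \<open>B \<ge> 0\<close>] by simp
qed

text \<open>
  The two alternatives describe the vertical lines halfway between zeros of the sine and the
  region at distance at least 1 from the real axis.
\<close>

lemma norm_sin_lower_bound:
  assumes "cos (2 * Re z) = -1 \<or> \<bar>Im z\<bar> \<ge> 1"
  shows "norm (sin z) \<ge> exp \<bar>Im z\<bar> / 4"
proof -
  define v where "v = \<bar>Im z\<bar>"
  have eq: "norm (sin z) ^ 2 = (exp (2 * v) + exp (- (2 * v)) - 2 * cos (2 * Re z)) / 4"
    unfolding v_def norm_sin_squared by (cases "Im z \<ge> 0") (auto simp: exp_minus)
  have sq: "(exp v / 4) ^ 2 = exp (2 * v) / 16"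
    by (simp add: power_divide flip: exp_double)
  have "(exp v / 4) ^ 2 \<le> norm (sin z) ^ 2"
    using assms
  proof
    assume "cos (2 * Re z) = -1"
    thus ?thesis unfolding eq sq by (simp add: add_increasing)
  next
    assume "\<bar>Im z\<bar> \<ge> 1"
    hence "exp (2 * v) \<ge> 1 + 2 * v + (2 * v)\<^sup>2 / 2"
      by (intro exp_lower_Taylor_quadratic) (auto simp: v_def)
    moreover have "v\<^sup>2 \<ge> 1" using \<open>\<bar>Im z\<bar> \<ge> 1\<close> unfolding v_def by (rule one_le_power)
    ultimately have v5: "exp (2 * v) \<ge> 5"
      using \<open>\<bar>Im z\<bar> \<ge> 1\<close> by (simp add: v_def power2_eq_square)
    have "X / 16 \<le> (X + Y - 2 * Z) / 4" if "X \<ge> 5" "Y \<ge> 0" "Z \<le> 1" for X Y Z :: real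
      using that by simp
    from this[OF v5 _ cos_le_one] show ?thesis unfolding eq sq by simp
  qed
  thus ?thesis unfolding v_def by (rule power2_le_imp_le) auto
qed

text \<open>
  The zeros of \<open>f\<close> cancel those of \<open>sin (\<pi> z)\<close>. Since \<open>\<bar>z\<bar> \<le> Re z + \<bar>Im z\<bar>\<close>, the quotient is
  bounded by a multiple of \<open>exp (c Re z - (\<pi> - c) \<bar>Im z\<bar>)\<close> on the grid lines, and \<open>c < \<pi>\<close> makes this
  decay in the imaginary direction.
\<close>

theorem Carlson:
  fixes f :: "complex \<Rightarrow> complex"
  assumes f: "f holomorphic_on {z. Re z > 0}"
    and c: "0 \<le> c" "c < pi"
    and bound: "\<And>z. Re z > 0 \<Longrightarrow> norm (f z) \<le> C * exp (c * norm z)"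
    and zero: "\<And>n::nat. n > 0 \<Longrightarrow> f (of_nat n) = 0"
    and w: "Re w > 0"
  shows "f w = 0"
proof -
  define s where "s z = sin (of_real pi * z)" for z :: complex
  have C: "C \<ge> 0"
    using bound[of 1] by (smt (verit) exp_gt_zero mult_neg_pos norm_ge_zero one_complex.simps(1))
  have ds: "deriv s z = of_real pi * cos (of_real pi * z)" for z
    unfolding s_def by (intro DERIV_imp_deriv derivative_eq_intros | simp)+
  obtain g where g: "g holomorphic_on {z. Re z > 0}" "\<And>z. Re z > 0 \<Longrightarrow> f z = g z * s z"
  proof (rule holomorphic_quotient_simple_zeros[of f "{z. Re z > 0}" s])
    show "s holomorphic_on {z. Re z > 0}" unfolding s_def by (intro holomorphic_intros)
    show "open {z. Re z > 0}" by (rule open_halfspace_Re_gt)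
    fix z assume z: "z \<in> {z. Re z > 0}" "s z = 0"
    then obtain k :: int where "of_real pi * z = of_real (of_int k * pi)"
      unfolding s_def Complex_Transcendental.sin_eq_0 by auto
    hence zk: "z = of_int k" by (simp add: mult_ac)
    with z have "k > 0" by simp
    hence "z = of_nat (nat k)" "nat k > 0" using zk by (auto simp: of_nat_nat)
    hence "f z = 0" using zero[of "nat k"] by metis
    moreover have "cos (of_real pi * z) \<noteq> 0"
      using sin_cos_squared_add[of "of_real pi * z :: complex"] z by (auto simp: s_def simp del: sin_cos_squared_add)
    ultimately show "f z = 0 \<and> deriv s z \<noteq> 0" by (simp add: ds)
  qed (use f in auto)
  have "g z = 0" if "Re z > 1/2" for z
  proof (rule zero_of_exponential_decay_on_grid[OF g(1)])
    show "norm (g z) \<le> (4 * C) * exp (c * Re z - (pi - c) * \<bar>Im z\<bar>)"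
      if z: "Re z \<ge> 1/2" "(\<exists>k::nat. Re z = of_nat k + 1/2) \<or> \<bar>Im z\<bar> \<ge> 1" for z
    proof -
      have "exp \<bar>Im (of_real pi * z)\<bar> / 4 \<le> norm (s z)"
        unfolding s_def
      proof (rule norm_sin_lower_bound)
        from z(2) show "cos (2 * Re (of_real pi * z)) = -1 \<or> \<bar>Im (of_real pi * z)\<bar> \<ge> 1"
        proof
          assume "\<exists>k::nat. Re z = of_nat k + 1/2"
          then obtain k :: nat where "Re z = of_nat k + 1/2" ..
          hence "2 * Re (of_real pi * z) = pi * of_int (2 * int k + 1)"
            by (simp add: algebra_simps)
          moreover have "cos (pi * of_int (2 * int k + 1)) = -1"
            by (subst cos_npi_int) simp
          ultimately show ?thesis by metis
        next
          assume "\<bar>Im z\<bar> \<ge> 1"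
          hence "1 * 1 \<le> pi * \<bar>Im z\<bar>" using pi_gt3 by (intro mult_mono) auto
          thus ?thesis by (simp add: abs_mult)
        qed
      qed
      hence s: "exp (pi * \<bar>Im z\<bar>) / 4 \<le> norm (s z)" by (simp add: abs_mult)
      have "norm (g z) * (exp (pi * \<bar>Im z\<bar>) / 4) \<le> norm (g z) * norm (s z)"
        using s by (rule mult_left_mono) auto
      also have "\<dots> = norm (f z)" using g(2)[of z] z by (simp add: norm_mult)
      also have "\<dots> \<le> C * exp (c * norm z)" using z by (intro bound) auto
      also have "\<dots> \<le> C * exp (c * (Re z + \<bar>Im z\<bar>))"
        using cmod_le[of z] z c C by (auto intro!: mult_left_mono)
      finally have "norm (g z) \<le> 4 * C * (exp (c * (Re z + \<bar>Im z\<bar>)) / exp (pi * \<bar>Im z\<bar>))"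
        by (simp add: field_simps)
      also have "exp (c * (Re z + \<bar>Im z\<bar>)) / exp (pi * \<bar>Im z\<bar>) = exp (c * Re z - (pi - c) * \<bar>Im z\<bar>)"
        by (simp add: algebra_simps flip: exp_diff)
      finally show ?thesis .
    qed
  qed (use c C that in auto)
  hence half: "f z = 0" if "Re z > 1/2" for z using g(2)[of z] that by simp
  show ?thesis
  proof (rule analytic_continuation_open[of "{z. Re z > 1/2}" "{z. Re z > 0}" f "\<lambda>_. 0"])
    show "open {z. Re z > 1/2}" by (rule open_halfspace_Re_gt)
    show "{z. Re z > 1/2} \<noteq> {}" by (auto intro!: exI[of _ 1])
    show "connected {z. Re z > 0}" by (intro convex_connected convex_halfspace_Re_gt)
  qed (use f w half in \<open>auto simp: open_halfspace_Re_gt\<close>)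
qed

section \<open>Complex differentiability in two variables\<close>

text \<open>
  The pointwise condition inside \<open>analytic2_on\<close>, isolated because it is closed under
  the products and substitutions from which \<open>p_fun\<close> is built.
\<close>

definition complex_differentiable2 :: "(complex \<times> complex \<Rightarrow> complex) \<Rightarrow> complex \<times> complex \<Rightarrow> bool" where
  "complex_differentiable2 f z \<longleftrightarrow> (\<exists>a b. (f has_derivative (\<lambda>(h, k). a * h + b * k)) (at z))"

lemma complex_differentiable2_mult:
  assumes "complex_differentiable2 f z" "complex_differentiable2 g z"
  shows "complex_differentiable2 (\<lambda>z. f z * g z) z"
proof -
  from assms obtain a b c d where
    "(f has_derivative (\<lambda>(h, k). a * h + b * k)) (at z)"
    "(g has_derivative (\<lambda>(h, k). c * h + d * k)) (at z)"
    unfolding complex_differentiable2_def by blast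
  from has_derivative_mult[OF this]
  have "((\<lambda>z. f z * g z) has_derivative
          (\<lambda>(h, k). (f z * c + a * g z) * h + (f z * d + b * g z) * k)) (at z)"
    by (simp add: case_prod_unfold algebra_simps)
  thus ?thesis unfolding complex_differentiable2_def by blast
qed

lemma complex_differentiable2_affine:
  assumes "g field_differentiable (at (\<alpha> * m + \<beta> * n + \<gamma>))"
  shows "complex_differentiable2 (\<lambda>(m, n). g (\<alpha> * m + \<beta> * n + \<gamma>)) (m, n)"
proof -
  define l where "l z = \<alpha> * fst z + \<beta> * snd z + \<gamma>" for z
  from assms obtain D where D: "(g has_field_derivative D) (at (l (m, n)))"
    unfolding field_differentiable_def l_def by auto
  have "(l has_derivative (\<lambda>z. \<alpha> * fst z + \<beta> * snd z)) (at (m, n))"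
    unfolding l_def by (auto intro!: derivative_eq_intros)
  from has_derivative_compose[OF this D[unfolded has_field_derivative_def]]
  have "((\<lambda>z. g (l z)) has_derivative (\<lambda>(h, k). (D * \<alpha>) * h + (D * \<beta>) * k)) (at (m, n))"
    by (simp add: case_prod_unfold algebra_simps)
  thus ?thesis unfolding complex_differentiable2_def l_def by (auto simp: case_prod_unfold)
qed

text \<open>
  The shifts allow for the arguments \<open>n + 1\<close> and \<open>m + 1\<close> of the beta integral in \<open>p_fun\<close>.
\<close>

lemma complex_differentiable2_swap:
  assumes "complex_differentiable2 f (n + c, m + d)"
  shows "complex_differentiable2 (\<lambda>(m, n). f (n + c, m + d)) (m, n)"
proof -
  define l where "l z = (snd z + c, fst z + d)" for z
  from assms obtain a b where D: "(f has_derivative (\<lambda>(h, k). a * h + b * k)) (at (l (m, n)))"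
    unfolding complex_differentiable2_def l_def by auto
  have "(l has_derivative (\<lambda>z. (snd z, fst z))) (at (m, n))"
    unfolding l_def by (auto intro!: derivative_eq_intros)
  from has_derivative_compose[OF this D]
  have "((\<lambda>z. f (l z)) has_derivative (\<lambda>(h, k). b * h + a * k)) (at (m, n))"
    by (simp add: case_prod_unfold algebra_simps)
  thus ?thesis unfolding complex_differentiable2_def l_def by (auto simp: case_prod_unfold)
qed

lemma
  assumes "complex_differentiable2 f (m, n)"
  shows complex_differentiable2_imp_fst: "(\<lambda>m. f (m, n)) field_differentiable (at m)"
    and complex_differentiable2_imp_snd: "(\<lambda>n. f (m, n)) field_differentiable (at n)"
proof -
  from assms obtain a b where D: "(f has_derivative (\<lambda>(h, k). a * h + b * k)) (at (m, n))"
    unfolding complex_differentiable2_def by blast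
  have "((\<lambda>m. (m, n)) has_derivative (\<lambda>h. (h, 0))) (at m)"
    "((\<lambda>n. (m, n)) has_derivative (\<lambda>k. (0, k))) (at n)"
    by (auto intro!: derivative_eq_intros)
  from this[THEN has_derivative_compose, OF D]
  have "((\<lambda>m. f (m, n)) has_field_derivative a) (at m)" "((\<lambda>n. f (m, n)) has_field_derivative b) (at n)"
    by (simp_all add: has_field_derivative_def)
  thus "(\<lambda>m. f (m, n)) field_differentiable (at m)" "(\<lambda>n. f (m, n)) field_differentiable (at n)"
    by (auto simp: field_differentiable_def)
qed

section \<open>The beta kernel and its dominating weight\<close>

text \<open>
  The integrand of \<open>incomplete_beta\<close> on \<open>[0, 1]\<close> in exponential form, where dependence on the exponents
  is visibly analytic and measurability in \<open>t\<close> is automatic.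
\<close>

definition beta_kernel :: "complex \<Rightarrow> complex \<Rightarrow> real \<Rightarrow> complex" where
  "beta_kernel a b t = (if 0 < t \<and> t < 1
     then exp ((a - 1) * of_real (ln t) + (b - 1) * of_real (ln (1 - t))) else 0)"

definition beta_weight :: "real \<Rightarrow> real \<Rightarrow> real \<Rightarrow> real" where
  "beta_weight \<alpha> \<beta> t = (if 0 < t \<and> t < 1
     then exp ((\<alpha> - 1) * ln t + (\<beta> - 1) * ln (1 - t)) else 0)"

lemma beta_weight_nonneg: "beta_weight \<alpha> \<beta> t \<ge> 0"
  by (simp add: beta_weight_def)

lemma norm_beta_kernel: "norm (beta_kernel a b t) = beta_weight (Re a) (Re b) t"
  by (simp add: beta_kernel_def beta_weight_def)

text \<open>
  Logarithms are negative on the unit interval, so larger exponents give a smaller weight.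
\<close>

lemma beta_weight_mono:
  assumes "\<alpha> \<le> \<alpha>'" "\<beta> \<le> \<beta>'"
  shows "beta_weight \<alpha>' \<beta>' t \<le> beta_weight \<alpha> \<beta> t"
proof (cases "0 < t \<and> t < 1")
  case True
  hence "(\<alpha>' - 1) * ln t + (\<beta>' - 1) * ln (1 - t) \<le> (\<alpha> - 1) * ln t + (\<beta> - 1) * ln (1 - t)"
    using assms by (intro add_mono mult_right_mono_neg) auto
  thus ?thesis using True by (simp add: beta_weight_def)
qed (auto simp: beta_weight_def)

lemma has_integral_beta_weight:
  assumes "\<alpha> > 0" "\<beta> > 0"
  shows "(beta_weight \<alpha> \<beta> has_integral Beta \<alpha> \<beta>) {0..1}"
proof (rule has_integral_eq[OF _ has_integral_Beta_real[OF assms]])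
  show "t powr (\<alpha> - 1) * (1 - t) powr (\<beta> - 1) = beta_weight \<alpha> \<beta> t" if "t \<in> {0..1}" for t
    using that by (auto simp: beta_weight_def powr_def exp_add)
qed

lemma incomplete_beta_eq_integral_kernel:
  assumes "y \<le> 1"
  shows "incomplete_beta y a b = integral {0..y} (beta_kernel a b)"
  unfolding incomplete_beta_def
proof (rule integral_cong)
  fix t assume t: "t \<in> {0..y}"
  show "of_real t powr (a - 1) * of_real (1 - t) powr (b - 1) = beta_kernel a b t"
  proof (cases "0 < t \<and> t < 1")
    case True
    hence "Ln (of_real t) = of_real (ln t)" "Ln (of_real (1 - t)) = of_real (ln (1 - t))"
      by (auto intro!: Ln_of_real simp del: of_real_diff)
    thus ?thesis using True by (auto simp: beta_kernel_def powr_def exp_add)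
  next
    case False
    \<comment> \<open>Both sides vanish here, as \<open>0 powr _ = 0\<close>.\<close>
    with t assms have "t = 0 \<or> t = 1" by auto
    thus ?thesis by (auto simp: beta_kernel_def)
  qed
qed

text \<open>
  The constant is uniform in the upper limit \<open>y\<close>: the majorant is integrated over all of \<open>[0, 1]\<close>.
\<close>

lemma
  fixes h :: "real \<Rightarrow> complex"
  assumes "\<alpha> > 0" "\<beta> > 0" and y: "0 \<le> y" "y \<le> 1"
    and h: "h \<in> borel_measurable borel"
    and le: "\<And>t. norm (h t) \<le> C * beta_weight \<alpha> \<beta> t"
  shows integrable_if_le_beta_weight: "h integrable_on {0..y}"
    and norm_integral_le_Beta: "norm (integral {0..y} h) \<le> C * Beta \<alpha> \<beta>"
proof -
  define W where "W t = C * beta_weight \<alpha> \<beta> t" for t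
  have W: "(W has_integral C * Beta \<alpha> \<beta>) {0..1}"
    unfolding W_def using has_integral_beta_weight[OF assms(1,2)] by (rule has_integral_mult_right)
  hence W1: "W integrable_on {0..1}" by blast
  hence Wy: "W integrable_on {0..y}"
    using y by (elim integrable_on_subinterval) auto
  show int: "h integrable_on {0..y}"
  proof (rule measurable_bounded_by_integrable_imp_integrable[OF _ Wy])
    show "h \<in> borel_measurable (lebesgue_on {0..y})"
      using h by (intro measurable_restrict_space1 measurable_completion) simp
  qed (use le in \<open>auto simp: W_def\<close>)
  have W0: "W t \<ge> 0" for t using le[of t] norm_ge_zero[of "h t"] unfolding W_def by linarith
  have "norm (integral {0..y} h) \<le> integral {0..y} W"
    by (rule integral_norm_bound_integral[OF int Wy]) (use le in \<open>auto simp: W_def\<close>)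
  also have "\<dots> \<le> integral {0..1} W"
    by (rule integral_subset_le[OF _ Wy W1]) (use y W0 in auto)
  also have "\<dots> = C * Beta \<alpha> \<beta>" using W by blast
  finally show "norm (integral {0..y} h) \<le> C * Beta \<alpha> \<beta>" .
qed

lemma measurable_beta_kernel [measurable]: "beta_kernel a b \<in> borel_measurable borel"
  unfolding beta_kernel_def by measurable

lemma beta_kernel_integrable:
  assumes "Re a > 0" "Re b > 0" "0 \<le> y" "y \<le> 1"
  shows "beta_kernel a b integrable_on {0..y}"
  by (rule integrable_if_le_beta_weight[of "Re a" "Re b" _ _ 1]) 
     (use assms in \<open>auto simp: norm_beta_kernel\<close>)

lemma norm_incomplete_beta_le:
  assumes "0 < \<alpha>" "\<alpha> \<le> Re a" "0 < \<beta>" "\<beta> \<le> Re b" "0 \<le> y" "y \<le> 1"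
  shows "norm (incomplete_beta y a b) \<le> Beta \<alpha> \<beta>"
proof -
  have "norm (integral {0..y} (beta_kernel a b)) \<le> 1 * Beta \<alpha> \<beta>"
    by (rule norm_integral_le_Beta) (use assms in \<open>auto simp: norm_beta_kernel intro: beta_weight_mono\<close>)
  thus ?thesis using assms by (simp add: incomplete_beta_eq_integral_kernel)
qed

lemma norm_exp_minus_Taylor1_le:
  fixes w :: complex
  shows "norm (exp w - 1 - w) \<le> norm w ^ 2 * exp (norm w)"
proof -
  have "norm (exp w - (\<Sum>k\<le>1. w ^ k / fact k)) \<le> exp \<bar>Re w\<bar> * norm w ^ Suc 1 / fact 1"
    by (rule Taylor_exp)
  also have "(\<Sum>k\<le>1. w ^ k / fact k) = 1 + w" by simp
  also have "exp \<bar>Re w\<bar> * norm w ^ Suc 1 / fact 1 \<le> exp (norm w) * norm w ^ 2"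
    using abs_Re_le_cmod[of w] by (simp add: power2_eq_square mult_right_mono)
  finally show ?thesis by (simp add: algebra_simps)
qed

text \<open>
  Lowering the exponents makes room for powers of \<open>- ln t - ln (1 - t)\<close>, which arise on differentiating
  the kernel in its parameters.
\<close>

lemma beta_weight_shift:
  assumes "0 < t" "t < 1"
  shows "beta_weight (\<alpha> - \<delta>) (\<beta> - \<delta>) t = beta_weight \<alpha> \<beta> t * exp (\<delta> * (- ln t - ln (1 - t)))"
  using assms by (simp add: beta_weight_def algebra_simps flip: exp_add)

section \<open>Analyticity of the incomplete beta function\<close>

text \<open>
  Moving the parameters by \<open>(h, k)\<close> multiplies the kernel by \<open>exp w\<close> with
  \<open>w = h ln t + k ln (1 - t)\<close>, and \<open>\<bar>w\<bar> \<le> \<bar>(h, k)\<bar> L\<close> for \<open>L = - ln t - ln (1 - t)\<close>.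
  The first-order Taylor remainder of \<open>exp\<close> therefore leaves an error of at most
  \<open>\<bar>(h, k)\<bar>^2 L^2 exp (\<delta> L)\<close> times the weight for \<open>\<bar>(h, k)\<bar> \<le> \<delta>\<close>, and this is dominated by a constant
  times the weight with both exponents lowered by \<open>2 \<delta>\<close>. Integrating gives a quadratic bound for the
  linearization error.
\<close>

lemma complex_differentiable2_integral_beta_kernel:
  assumes "Re a > 0" "Re b > 0" and y: "0 \<le> y" "y \<le> 1"
  shows "complex_differentiable2 (\<lambda>(a, b). integral {0..y} (beta_kernel a b)) (a, b)"
proof -
  define \<delta> where "\<delta> = min (Re a) (Re b) / 4"
  define \<alpha> where "\<alpha> = Re a - 2 * \<delta>"
  define \<beta> where "\<beta> = Re b - 2 * \<delta>"
  have pos: "\<delta> > 0" "\<alpha> > 0" "\<beta> > 0" "\<delta> < Re a" "\<delta> < Re b"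
    using assms by (auto simp: \<delta>_def \<alpha>_def \<beta>_def min_def)
  define L where "L t = - ln t - ln (1 - t)" for t :: real
  define C where "C = 2 / \<delta>\<^sup>2"
  define A where "A t = of_real (ln t) * beta_kernel a b t" for t
  define B where "B t = of_real (ln (1 - t)) * beta_kernel a b t" for t
  have L0: "L t \<ge> 0" if "0 < t" "t < 1" for t
  proof -
    have "ln t \<le> 0" "ln (1 - t) \<le> 0" using that by auto
    thus ?thesis by (simp add: L_def)
  qed
  have shift: "beta_weight \<alpha> \<beta> t = beta_weight (Re a) (Re b) t * exp (2 * \<delta> * L t)" if "0 < t" "t < 1" for t
    unfolding L_def \<alpha>_def \<beta>_def using that by (rule beta_weight_shift)
  have W: "beta_weight (Re a) (Re b) t * (L t ^ 2 * exp (\<delta> * L t)) \<le> C * beta_weight \<alpha> \<beta> t"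
    if t: "0 < t" "t < 1" for t
  proof -
    have "\<delta> * L t \<ge> 0" using L0[OF t] pos by simp
    hence "(\<delta> * L t)\<^sup>2 / 2 \<le> exp (\<delta> * L t)"
      using exp_lower_Taylor_quadratic[of "\<delta> * L t"] by linarith
    hence "L t ^ 2 \<le> C * exp (\<delta> * L t)"
      using pos by (simp add: power_mult_distrib field_simps C_def)
    hence "beta_weight (Re a) (Re b) t * (L t ^ 2 * exp (\<delta> * L t)) \<le>
             beta_weight (Re a) (Re b) t * (C * exp (\<delta> * L t) * exp (\<delta> * L t))"
      by (intro mult_left_mono mult_right_mono beta_weight_nonneg) auto
    also have "\<dots> = C * beta_weight \<alpha> \<beta> t"
      by (simp add: shift[OF t] mult_ac flip: exp_add)
    finally show ?thesis .
  qed
  have lnL: "\<bar>ln t\<bar> \<le> L t" "\<bar>ln (1 - t)\<bar> \<le> L t" if "0 < t" "t < 1" for t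
  proof -
    have "ln t \<le> 0" "ln (1 - t) \<le> 0" using that by auto
    thus "\<bar>ln t\<bar> \<le> L t" "\<bar>ln (1 - t)\<bar> \<le> L t" by (auto simp: L_def)
  qed
  have ptw: "norm (beta_kernel (a + h) (b + k) t - beta_kernel a b t - (A t * h + B t * k))
      \<le> norm (h, k) ^ 2 * C * beta_weight \<alpha> \<beta> t" if hk: "norm (h, k) \<le> \<delta>" for h k t
  proof (cases "0 < t \<and> t < 1")
    case True
    define w where "w = h * of_real (ln t) + k * of_real (ln (1 - t))"
    have h: "norm h \<le> norm (h, k)" "norm k \<le> norm (h, k)"
      by (metis fst_conv norm_fst_le) (metis snd_conv norm_snd_le)
    have "norm w \<le> norm h * \<bar>ln t\<bar> + norm k * \<bar>ln (1 - t)\<bar>"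
      unfolding w_def by (rule norm_triangle_le) (simp add: norm_mult)
    also have "\<dots> \<le> norm (h, k) * \<bar>ln t\<bar> + norm (h, k) * \<bar>ln (1 - t)\<bar>"
      using h by (intro add_mono mult_right_mono) auto
    also have "\<dots> = norm (h, k) * L t"
      using True by (simp add: L_def algebra_simps)
    finally have w: "norm w \<le> norm (h, k) * L t" .
    also have "\<dots> \<le> \<delta> * L t" using L0 True hk by (intro mult_right_mono) auto
    finally have w': "norm w \<le> \<delta> * L t" .
    have "beta_kernel (a + h) (b + k) t = beta_kernel a b t * exp w"
      using True by (simp add: beta_kernel_def w_def algebra_simps flip: exp_add)
    hence "beta_kernel (a + h) (b + k) t - beta_kernel a b t - (A t * h + B t * k) = 
            beta_kernel a b t * (exp w - 1 - w)"
      by (simp add: A_def B_def w_def algebra_simps)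
    also have "norm \<dots> \<le> beta_weight (Re a) (Re b) t * ((norm (h, k) * L t) ^ 2 * exp (\<delta> * L t))"
      unfolding norm_mult norm_beta_kernel
    proof (intro mult_left_mono beta_weight_nonneg)
      have "norm (exp w - 1 - w) \<le> norm w ^ 2 * exp (norm w)"
        by (rule norm_exp_minus_Taylor1_le)
      also have "\<dots> \<le> (norm (h, k) * L t) ^ 2 * exp (\<delta> * L t)"
        using w w' by (intro mult_mono power_mono) auto
      finally show "norm (exp w - 1 - w) \<le> (norm (h, k) * L t) ^ 2 * exp (\<delta> * L t)" .
    qed
    also have "\<dots> = norm (h, k) ^ 2 * (beta_weight (Re a) (Re b) t * (L t ^ 2 * exp (\<delta> * L t)))"
      by (simp only: power_mult_distrib mult_ac)
    also have "\<dots> \<le> norm (h, k) ^ 2 * (C * beta_weight \<alpha> \<beta> t)"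
      using W True by (intro mult_left_mono) auto
    finally show ?thesis by (simp only: mult_ac)
  qed (auto simp: beta_kernel_def A_def B_def beta_weight_def)

  have log_bound: "norm (of_real l * beta_kernel a b t) \<le> 1 / \<delta> * beta_weight \<alpha> \<beta> t"
    if l: "0 < t \<Longrightarrow> t < 1 \<Longrightarrow> \<bar>l\<bar> \<le> L t" for l t
  proof (cases "0 < t \<and> t < 1")
    case True
    have "\<delta> * L t \<ge> 0" using L0[of t] True pos by simp
    hence "\<delta> * L t \<le> exp (2 * \<delta> * L t)"
      using exp_ge_add_one_self[of "2 * \<delta> * L t"] by linarith
    hence "L t \<le> 1 / \<delta> * exp (2 * \<delta> * L t)"
      using pos by (simp add: field_simps)
    hence "\<bar>l\<bar> \<le> 1 / \<delta> * exp (2 * \<delta> * L t)" using l True by force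
    hence "\<bar>l\<bar> * beta_weight (Re a) (Re b) t \<le> 1 / \<delta> * exp (2 * \<delta> * L t) * beta_weight (Re a) (Re b) t"
      by (rule mult_right_mono) (rule beta_weight_nonneg)
    thus ?thesis using True by (simp add: norm_mult norm_beta_kernel shift mult_ac)
  qed (auto simp: beta_kernel_def beta_weight_def)
  have Aint: "A integrable_on {0..y}" and Bint: "B integrable_on {0..y}"
    unfolding A_def B_def
    by (rule integrable_if_le_beta_weight[OF pos(2,3) y _ log_bound]; 
        (use lnL in auto | measurable))+
  define A' where "A' = integral {0..y} A"
  define B' where "B' = integral {0..y} B"
  have "((\<lambda>(a, b). integral {0..y} (beta_kernel a b)) has_derivative (\<lambda>(h, k). A' * h + B' * k)) (at (a, b))"
  proof (rule has_derivativeI_sandwich[OF pos(1)])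
    show "bounded_linear (\<lambda>(h, k). A' * h + B' * k)"
      unfolding case_prod_unfold
      by (intro bounded_linear_add bounded_linear_const_mult bounded_linear_fst bounded_linear_snd)
    show "((\<lambda>z. norm (z - (a, b)) * (C * Beta \<alpha> \<beta>)) \<longlongrightarrow> 0) (at (a, b))"
      by (rule tendsto_eq_intros refl | simp)+
    fix z :: "complex \<times> complex"
    assume z: "z \<noteq> (a, b)" "dist z (a, b) < \<delta>"
    obtain h k where hk: "z = (a + h, b + k)"
      by (metis add.commute diff_add_cancel surj_pair)
    have n: "norm (h, k) = norm (z - (a, b))" by (simp add: hk)
    have n': "norm (h, k) < \<delta>" using z by (simp add: n dist_norm)
    have "norm h < \<delta>" "norm k < \<delta>"
      using norm_fst_le[of h k] norm_snd_le[of k h] n' by linarith+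
    hence "Re a + Re h > 0" "Re b + Re k > 0"
      using pos abs_Re_le_cmod[of h] abs_Re_le_cmod[of k] by linarith+
    hence i1: "beta_kernel (a + h) (b + k) integrable_on {0..y}"
      using y by (intro beta_kernel_integrable) auto
    have i2: "beta_kernel a b integrable_on {0..y}"
      using assms by (intro beta_kernel_integrable) auto
    have i3: "(\<lambda>t. A t * h + B t * k) integrable_on {0..y}"
      by (intro integrable_add integrable_on_mult_left Aint Bint)
    have i4: "integral {0..y} (\<lambda>t. A t * h + B t * k) = A' * h + B' * k"
      unfolding A'_def B'_def using Aint Bint
      by (subst integral_add) (auto intro: integrable_on_mult_left)
    have "norm (integral {0..y} (\<lambda>t. beta_kernel (a + h) (b + k) t - beta_kernel a b t - (A t * h + B t * k)))
        \<le> norm (h, k) ^ 2 * C * Beta \<alpha> \<beta>"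
      by (rule norm_integral_le_Beta[OF pos(2,3) y _ ptw]) (use n' in \<open>auto simp: A_def B_def\<close>)
    also have "integral {0..y} (\<lambda>t. beta_kernel (a + h) (b + k) t - beta_kernel a b t - (A t * h + B t * k))
        = integral {0..y} (beta_kernel (a + h) (b + k)) - integral {0..y} (beta_kernel a b) - (A' * h + B' * k)"
      using i1 i2 i3 i4 by (simp add: integral_diff integrable_diff)
    finally show "norm ((case z of (a, b) \<Rightarrow> integral {0..y} (beta_kernel a b)) -
       (case (a, b) of (a, b) \<Rightarrow> integral {0..y} (beta_kernel a b)) -
       (case z - (a, b) of (h, k) \<Rightarrow> A' * h + B' * k)) / norm (z - (a, b))
       \<le> norm (z - (a, b)) * (C * Beta \<alpha> \<beta>)"
      using z unfolding n[symmetric] 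
      by (simp add: hk divide_simps power2_eq_square mult_ac)
  qed
  thus ?thesis unfolding complex_differentiable2_def by blast
qed

lemma complex_differentiable2_incomplete_beta:
  assumes "Re a > 0" "Re b > 0" and y: "0 \<le> y" "y \<le> 1"
  shows "complex_differentiable2 (\<lambda>(a, b). incomplete_beta y a b) (a, b)"
  using complex_differentiable2_integral_beta_kernel[OF assms] y
  by (simp add: incomplete_beta_eq_integral_kernel)

lemma
  assumes y: "0 \<le> y" "y \<le> 1"
  shows holomorphic_incomplete_beta_fst: "Re b > 0 \<Longrightarrow> (\<lambda>a. incomplete_beta y a b) holomorphic_on {z. Re z > 0}"
    and holomorphic_incomplete_beta_snd: "Re a > 0 \<Longrightarrow> (\<lambda>b. incomplete_beta y a b) holomorphic_on {z. Re z > 0}"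
proof -
  have *: "complex_differentiable2 (\<lambda>(a, b). incomplete_beta y a b) (a, b)" if "Re a > 0" "Re b > 0" for a b
    using that y by (rule complex_differentiable2_incomplete_beta)
  show "(\<lambda>a. incomplete_beta y a b) holomorphic_on {z. Re z > 0}" if "Re b > 0"
    unfolding holomorphic_on_def using complex_differentiable2_imp_fst[OF *[OF _ that]]
    by (auto intro: field_differentiable_at_within)
  show "(\<lambda>b. incomplete_beta y a b) holomorphic_on {z. Re z > 0}" if "Re a > 0"
    unfolding holomorphic_on_def using complex_differentiable2_imp_snd[OF *[OF that]]
    by (auto intro: field_differentiable_at_within)
qed

section \<open>The complete beta integral and the reflection formula\<close>

lemma Re_pos_not_nonpos_Ints: "Re z > 0 \<Longrightarrow> z \<notin> \<int>\<^sub>\<le>\<^sub>0"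
  by (auto elim!: nonpos_Ints_cases)

lemma Gamma_nonzero_Re_pos: "Re z > 0 \<Longrightarrow> Gamma z \<noteq> 0"
  by (simp add: Gamma_eq_zero_iff Re_pos_not_nonpos_Ints)

text \<open>
  The positive reals accumulate at 1, so the identity theorem applies.
\<close>

lemma holomorphic_eq_if_eq_on_positive_reals:
  fixes f g :: "complex \<Rightarrow> complex"
  assumes "f holomorphic_on {z. Re z > 0}" "g holomorphic_on {z. Re z > 0}"
    and eq: "\<And>x. x > 0 \<Longrightarrow> f (of_real x) = g (of_real x)" and w: "Re w > 0"
  shows "f w = g w"
proof -
  have "f w - g w = 0"
  proof (rule analytic_continuation[where f = "\<lambda>z. f z - g z" and U = "of_real ` {0<..}" and \<xi> = 1])
    show "(\<lambda>z. f z - g z) holomorphic_on {z. Re z > 0}" by (intro holomorphic_intros assms)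
    show "connected {z. Re z > 0}" by (intro convex_connected convex_halfspace_Re_gt)
    show "(1::complex) islimpt of_real ` {0<..}"
      unfolding islimpt_approachable
    proof (intro allI impI)
      fix e :: real assume "e > 0"
      thus "\<exists>x'\<in>of_real ` {0<..}. x' \<noteq> 1 \<and> dist x' (1::complex) < e"
        by (intro bexI[of _ "of_real (1 + e / 2)"] imageI) (auto simp: dist_norm)
    qed
  qed (use eq w in \<open>auto simp: open_halfspace_Re_gt\<close>)
  thus ?thesis by simp
qed

lemma incomplete_beta_1_of_real:
  assumes "\<alpha> > 0" "\<beta> > 0"
  shows "incomplete_beta 1 (of_real \<alpha>) (of_real \<beta>) = Beta (of_real \<alpha>) (of_real \<beta>)"
proof -
  have "((\<lambda>t. complex_of_real (beta_weight \<alpha> \<beta> t)) has_integral of_real (Beta \<alpha> \<beta>)) {0..1}"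
    using has_integral_linear[OF has_integral_beta_weight[OF assms] bounded_linear_of_real]
    by (simp add: o_def)
  also have "(\<lambda>t. complex_of_real (beta_weight \<alpha> \<beta> t)) = beta_kernel (of_real \<alpha>) (of_real \<beta>)"
    by (auto simp: beta_weight_def beta_kernel_def simp flip: exp_of_real)
  finally show ?thesis
    by (simp add: incomplete_beta_eq_integral_kernel Beta_complex_of_real integral_unique)
qed

lemma holomorphic_Beta_fst:
  assumes "Re b > 0"
  shows "(\<lambda>a. Beta a b) holomorphic_on {z. Re z > 0}"
  unfolding Beta_def using assms
  by (intro holomorphic_intros) (auto simp: Gamma_nonzero_Re_pos intro!: Re_pos_not_nonpos_Ints)

text \<open>
  The identity theorem extends the real formula first to complex \<open>a\<close> with real \<open>b\<close>, and then to
  complex \<open>b\<close> for each fixed complex \<open>a\<close>.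
\<close>

theorem incomplete_beta_1:
  assumes "Re a > 0" "Re b > 0"
  shows "incomplete_beta 1 a b = Beta a b"
proof -
  have *: "incomplete_beta 1 a (of_real \<beta>) = Beta a (of_real \<beta>)" if "Re a > 0" "\<beta> > 0" for a \<beta>
    by (rule holomorphic_eq_if_eq_on_positive_reals[of "\<lambda>a. incomplete_beta 1 a (of_real \<beta>)"])
       (use that in \<open>auto intro!: holomorphic_incomplete_beta_fst holomorphic_Beta_fst incomplete_beta_1_of_real\<close>)
  have "(\<lambda>b. Beta a b) holomorphic_on {z. Re z > 0}"
    using holomorphic_Beta_fst[OF assms(1)] by (simp add: Beta_commute)
  thus ?thesis
    by (rule holomorphic_eq_if_eq_on_positive_reals[of "incomplete_beta 1 a", rotated])
       (use assms * in \<open>auto intro!: holomorphic_incomplete_beta_snd\<close>)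
qed

theorem incomplete_beta_reflection:
  assumes "Re a > 0" "Re b > 0" "0 \<le> y" "y \<le> 1"
  shows "incomplete_beta y a b + incomplete_beta (1 - y) b a = Beta a b"
proof -
  have int1: "beta_kernel a b integrable_on {0..1}" using assms by (intro beta_kernel_integrable) auto
  have "beta_kernel a b integrable_on {y..1}"
    by (rule integrable_on_subinterval[OF int1]) (use assms in auto)
  hence "(beta_kernel a b has_integral integral {y..1} (beta_kernel a b)) (cbox y 1)"
    by (simp add: has_integral_integral)
  from has_integral_affinity[OF this, of "-1" 1]
  have "((\<lambda>t. beta_kernel a b (1 - t)) has_integral integral {y..1} (beta_kernel a b)) ((\<lambda>x. 1 - x) ` {y..1})"
    by (simp add: algebra_simps)
  also have "(\<lambda>x. 1 - x) ` {y..1} = {0..1 - y}"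
    using assms by (simp add: image_diff_atLeastAtMost)
  also have "(\<lambda>t. beta_kernel a b (1 - t)) = beta_kernel b a"
    by (auto simp: beta_kernel_def add.commute)
  finally have "integral {0..1 - y} (beta_kernel b a) = integral {y..1} (beta_kernel a b)"
    by (rule integral_unique)
  moreover have "integral {0..y} (beta_kernel a b) + integral {y..1} (beta_kernel a b) =
                   integral {0..1} (beta_kernel a b)"
    using assms int1 by (intro Henstock_Kurzweil_Integration.integral_combine) auto
  ultimately show ?thesis
    using incomplete_beta_1[OF assms(1,2)] assms by (simp add: incomplete_beta_eq_integral_kernel)
qed

section \<open>Complementarity and analyticity\<close>

lemma p_fun_add_q_fun:
  assumes "0 < x" "x < 1" "Re m > -1" "Re n > -1"
  shows "p_fun x m n + q_fun x m n = 1"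
proof -
  have "p_fun x m n + q_fun x m n = Gamma (m + n + 2) / (Gamma (m + 1) * Gamma (n + 1)) *
      (incomplete_beta (1 - x) (n + 1) (m + 1) + incomplete_beta (1 - (1 - x)) (m + 1) (n + 1))"
    unfolding p_fun_def q_fun_def by (simp add: algebra_simps)
  also have "\<dots> = Gamma (m + n + 2) / (Gamma (m + 1) * Gamma (n + 1)) * Beta (n + 1) (m + 1)"
    using assms by (subst incomplete_beta_reflection) auto
  also have "\<dots> = 1"
    using assms Gamma_nonzero_Re_pos[of "m + 1"] Gamma_nonzero_Re_pos[of "n + 1"]
      Gamma_nonzero_Re_pos[of "m + n + 2"]
    by (simp add: Beta_def add_ac)
  finally show ?thesis .
qed

text \<open>
  Written with the entire function \<open>rGamma = 1 / \<Gamma>\<close>, \<open>p_fun\<close> is a product of holomorphic functions of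
  affine forms and of the incomplete beta function.
\<close>

lemma complex_differentiable2_p_fun:
  assumes "0 < x" "x < 1" "Re m > -1" "Re n > -1"
  shows "complex_differentiable2 (\<lambda>(m, n). p_fun x m n) (m, n)"
proof -
  have "complex_differentiable2 (\<lambda>(m, n). Gamma (1 * m + 1 * n + 2)) (m, n)"
    by (rule complex_differentiable2_affine)
       (use assms in \<open>auto intro!: field_differentiable_Gamma Re_pos_not_nonpos_Ints\<close>)
  moreover have "complex_differentiable2 (\<lambda>(m, n). rGamma (1 * m + 0 * n + 1)) (m, n)"
    "complex_differentiable2 (\<lambda>(m, n). rGamma (0 * m + 1 * n + 1)) (m, n)"
    by (rule complex_differentiable2_affine field_differentiable_rGamma)+
  moreover have "complex_differentiable2 (\<lambda>(m, n). (\<lambda>(a, b). incomplete_beta (1 - x) a b) (n + 1, m + 1)) (m, n)"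
    using assms by (intro complex_differentiable2_swap complex_differentiable2_incomplete_beta) auto
  ultimately have "complex_differentiable2 (\<lambda>z. (case z of (m, n) \<Rightarrow> Gamma (1 * m + 1 * n + 2)) *
      ((case z of (m, n) \<Rightarrow> rGamma (1 * m + 0 * n + 1)) * (case z of (m, n) \<Rightarrow> rGamma (0 * m + 1 * n + 1))) *
      (case z of (m, n) \<Rightarrow> (\<lambda>(a, b). incomplete_beta (1 - x) a b) (n + 1, m + 1))) (m, n)"
    by (intro complex_differentiable2_mult)
  thus ?thesis
    by (simp add: p_fun_def case_prod_unfold Gamma_def divide_inverse mult_ac)
qed

lemma complex_differentiable2_q_fun:
  assumes "0 < x" "x < 1" "Re m > -1" "Re n > -1"
  shows "complex_differentiable2 (\<lambda>(m, n). q_fun x m n) (m, n)"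
  using complex_differentiable2_swap[OF complex_differentiable2_p_fun[of "1 - x" "n + 0" "m + 0"]] assms
  by (simp add: q_fun_def)

lemma analytic2_on_right_half_planeI:
  assumes "\<And>m n. Re m > -1 \<Longrightarrow> Re n > -1 \<Longrightarrow> complex_differentiable2 f (m, n)"
  shows "analytic2_on f (right_half_plane \<times> right_half_plane)"
  unfolding analytic2_on_def
proof (intro exI[of _ "right_half_plane \<times> right_half_plane"] conjI)
  show "open (right_half_plane \<times> right_half_plane)"
    unfolding right_half_plane_def by (intro open_Times open_halfspace_Re_gt)
qed (use assms in \<open>auto simp: right_half_plane_def complex_differentiable2_def\<close>)

lemma analytic2_on_imp_holomorphic:
  assumes "analytic2_on (\<lambda>(m, n). f m n) (right_half_plane \<times> right_half_plane)"
  shows "m \<in> right_half_plane \<Longrightarrow> (\<lambda>n. f m n) holomorphic_on right_half_plane"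
    and "n \<in> right_half_plane \<Longrightarrow> (\<lambda>m. f m n) holomorphic_on right_half_plane"
proof -
  have *: "complex_differentiable2 (\<lambda>(m, n). f m n) (m, n)" 
    if "m \<in> right_half_plane" "n \<in> right_half_plane" for m n
    using assms that unfolding analytic2_on_def complex_differentiable2_def by blast
  show "(\<lambda>n. f m n) holomorphic_on right_half_plane" if "m \<in> right_half_plane"
    unfolding holomorphic_on_def using complex_differentiable2_imp_snd[OF *[OF that]]
    by (auto intro: field_differentiable_at_within)
  show "(\<lambda>m. f m n) holomorphic_on right_half_plane" if "n \<in> right_half_plane"
    unfolding holomorphic_on_def using complex_differentiable2_imp_fst[OF *[OF _ that]]
    by (auto intro: field_differentiable_at_within)
qed

section \<open>Values at nonnegative integers\<close>

text \<open>
  The finite sum in the interpolation property, as a polynomial in \<open>y = 1 - x\<close>, the upper limit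
  of the beta integral.
\<close>

definition p_poly :: "nat \<Rightarrow> nat \<Rightarrow> real \<Rightarrow> real" where
  "p_poly m n y = y ^ (n + 1) * (\<Sum>k=0..m. pochhammer (of_nat n + 1) k / fact k * (1 - y) ^ k)"

lemma pochhammer_of_nat_add_1: "pochhammer (of_nat n + 1 :: real) k = fact (n + k) / fact n"
  by (induction k) (simp_all add: pochhammer_Suc algebra_simps add_divide_distrib)

text \<open>
  Passing from \<open>m\<close> to \<open>m + 1\<close> adds \<open>c y^(n+1) (1-y)^(m+1)\<close>, and with
  \<open>c = (m+n+1)! / ((m+1)! n!)\<close> the derivatives combine because
  \<open>(m+1) + (n+1) (1-y) - (m+1) y = (m+n+2) (1-y)\<close>.
\<close>

lemma has_field_derivative_p_poly:
  "(p_poly m n has_field_derivative fact (m + n + 1) / (fact m * fact n) * (y ^ n * (1 - y) ^ m)) (at y)"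
proof (induction m)
  case 0
  have "p_poly 0 n = (\<lambda>y. y ^ (n + 1))" by (simp add: p_poly_def fun_eq_iff)
  thus ?case using DERIV_pow[of "n + 1" y] by simp
next
  case (Suc m)
  define c :: real where "c = pochhammer (of_nat n + 1) (Suc m) / fact (Suc m)"
  have c: "c = fact (m + n + 1) / (fact (Suc m) * fact n)"
    by (simp only: c_def pochhammer_of_nat_add_1) (simp add: add_ac)
  have c1: "fact (m + n + 1) / (fact m * fact n) = c * real (m + 1)"
    unfolding c by (simp add: divide_simps)
  have c2: "fact (Suc m + n + 1) / (fact (Suc m) * fact n) = c * real (m + n + 2)"
    unfolding c by (simp add: algebra_simps add_divide_distrib)
  have eq: "p_poly (Suc m) n = (\<lambda>y. p_poly m n y + c * (y ^ (n + 1) * (1 - y) ^ (m + 1)))"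
    by (simp add: fun_eq_iff p_poly_def c_def distrib_left mult_ac)
  show ?case
    unfolding eq
    apply (rule derivative_eq_intros Suc.IH refl)+
    unfolding c1 c2 by (simp add: algebra_simps)
qed

lemma p_fun_of_nat:
  assumes "0 < x" "x < 1"
  shows "p_fun x (of_nat m) (of_nat n) = of_real (p_poly m n (1 - x))"
proof -
  define K :: real where "K = fact (m + n + 1) / (fact m * fact n)"
  have "((\<lambda>y. K * (y ^ n * (1 - y) ^ m)) has_integral p_poly m n (1 - x) - p_poly m n 0) {0..1 - x}"
  proof (rule fundamental_theorem_of_calculus)
    show "(p_poly m n has_vector_derivative K * (y ^ n * (1 - y) ^ m)) (at y within {0..1 - x})" for y
      unfolding K_def has_real_derivative_iff_has_vector_derivative[symmetric]
      by (rule has_field_derivative_at_within[OF has_field_derivative_p_poly])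
  qed (use assms in auto)
  also have "p_poly m n 0 = 0" by (simp add: p_poly_def)
  finally have "((\<lambda>y. K * (y ^ n * (1 - y) ^ m)) has_integral p_poly m n (1 - x)) {0..1 - x}" by simp
  from has_integral_linear[OF this bounded_linear_of_real]
  have "((\<lambda>y. complex_of_real (K * (y ^ n * (1 - y) ^ m))) has_integral of_real (p_poly m n (1 - x))) {0..1 - x}"
    by (simp add: o_def)
  hence "((\<lambda>y. of_real K * beta_kernel (of_nat n + 1) (of_nat m + 1) y) has_integral of_real (p_poly m n (1 - x))) {0..1 - x}"
  \<comment> \<open>For \<open>n = 0\<close> the two integrands differ at 0: \<open>y ^ 0 = 1\<close>, but the kernel vanishes.\<close>
  proof (rule has_integral_spike[of "{0}", rotated 2])
    fix y assume y: "y \<in> {0..1 - x} - {0}"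
    hence "y > 0" "y < 1" using assms by auto
    hence "exp (of_nat n * of_real (ln y)) = (of_real y ^ n :: complex)"
       "exp (of_nat m * of_real (ln (1 - y))) = (of_real (1 - y) ^ m :: complex)"
      by (simp_all add: exp_of_nat_mult exp_of_real del: of_real_diff)
    thus "of_real K * beta_kernel (of_nat n + 1) (of_nat m + 1) y = complex_of_real (K * (y ^ n * (1 - y) ^ m))"
      using \<open>y > 0\<close> \<open>y < 1\<close> by (simp add: beta_kernel_def exp_add)
  qed simp
  hence "of_real K * integral {0..1 - x} (beta_kernel (of_nat n + 1) (of_nat m + 1)) = of_real (p_poly m n (1 - x))"
    by (simp add: integral_unique flip: integral_mult_right)
  moreover have "Gamma (of_nat m + of_nat n + 2) / (Gamma (of_nat m + 1) * Gamma (of_nat n + 1)) = complex_of_real K"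
    using Gamma_fact[of m, where 'a = complex] Gamma_fact[of n, where 'a = complex] 
      Gamma_fact[of "m + n + 1", where 'a = complex]
    by (simp add: K_def add_ac)
  ultimately show ?thesis
    using assms by (simp add: p_fun_def incomplete_beta_eq_integral_kernel)
qed

section \<open>Exponential growth bounds\<close>

lemma exp_bounded_iff:
  "exp_bounded c f \<longleftrightarrow> (\<exists>C. \<forall>z. Re z \<ge> 0 \<longrightarrow> norm (f z) \<le> C * exp (c * norm z))"
proof
  assume "exp_bounded c f"
  thus "\<exists>C. \<forall>z. Re z \<ge> 0 \<longrightarrow> norm (f z) \<le> C * exp (c * norm z)"
    unfolding exp_bounded_def by (elim landau_o.bigE) (auto simp: eventually_principal)
next
  assume "\<exists>C. \<forall>z. Re z \<ge> 0 \<longrightarrow> norm (f z) \<le> C * exp (c * norm z)"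
  then obtain C where "\<forall>z. Re z \<ge> 0 \<longrightarrow> norm (f z) \<le> C * exp (c * norm z)" ..
  thus "exp_bounded c f"
    unfolding exp_bounded_def by (intro bigoI[of _ C]) (simp add: eventually_principal)
qed

lemma exp_bounded_mult_bounded:
  assumes "exp_bounded c f" "\<And>z. Re z \<ge> 0 \<Longrightarrow> norm (g z) \<le> B"
  shows "exp_bounded c (\<lambda>z. f z * g z)"
proof -
  obtain C where C: "\<And>z. Re z \<ge> 0 \<Longrightarrow> norm (f z) \<le> C * exp (c * norm z)"
    using assms(1) unfolding exp_bounded_iff by blast
  have "norm (f z * g z) \<le> (C * B) * exp (c * norm z)" if z: "Re z \<ge> 0" for z
  proof -
    have "norm (f z) * norm (g z) \<le> (C * exp (c * norm z)) * B"
      using C[OF z] assms(2)[OF z] by (intro mult_mono) (auto intro: order_trans[OF norm_ge_zero])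
    thus ?thesis by (simp add: norm_mult mult_ac)
  qed
  thus ?thesis unfolding exp_bounded_iff by blast
qed

text \<open>
  Each factor is at most \<open>u = \<bar>z\<bar> + N\<close>, and \<open>u^N / N!\<close> is a single term of the series for \<open>exp u\<close>.
\<close>

lemma norm_pochhammer_le_exp:
  fixes z :: complex
  shows "norm (pochhammer z N) \<le> fact N * exp (norm z + real N)"
proof -
  have "norm (pochhammer z N) \<le> (norm z + real N) ^ N"
  proof -
    have "norm (pochhammer z N) = (\<Prod>i<N. norm (z + of_nat i))"
      by (simp add: pochhammer_prod prod_norm lessThan_atLeast0)
    also have "\<dots> \<le> (\<Prod>i<N. norm z + real N)"
      by (intro prod_mono conjI norm_ge_zero norm_triangle_le) auto
    finally show ?thesis by simp
  qed
  also have "(norm z + real N) ^ N / fact N \<le> exp (norm z + real N)"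
  proof -
    define u where "u = norm z + real N"
    have "(\<Sum>k\<in>{N}. u ^ k / fact k) \<le> (\<Sum>k. u ^ k / fact k)"
      using summable_exp[of u] by (intro sum_le_suminf) (auto simp: u_def field_simps)
    thus ?thesis by (simp add: exp_def u_def scaleR_conv_of_real field_simps)
  qed
  hence "(norm z + real N) ^ N \<le> fact N * exp (norm z + real N)" by (simp add: field_simps)
  finally show ?thesis .
qed

text \<open>
  With \<open>u = z + 1\<close> and an integer \<open>N > Re s\<close>,
  \<open>\<Gamma>(u + s) / \<Gamma>(u) = (u)_N * Beta (u + s) (N - s) / \<Gamma>(N - s)\<close>. The integral for this Beta value is
  bounded uniformly in \<open>Re u > 0\<close>, so the growth is that of the Pochhammer polynomial.
\<close>

lemma exp_bounded_Gamma_ratio: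
  assumes s: "Re s > 0"
  shows "exp_bounded 1 (\<lambda>z. Gamma (z + 1 + s) / Gamma (z + 1))"
proof -
  obtain N :: nat where N: "real N > Re s" using reals_Archimedean2 by blast
  define C where "C = fact N * exp (1 + real N) * (Beta (Re s) (real N - Re s) / norm (Gamma (of_nat N - s)))"
  have "norm (Gamma (z + 1 + s) / Gamma (z + 1)) \<le> C * exp (1 * norm z)" if z: "Re z \<ge> 0" for z
  proof -
    define u where "u = z + 1"
    have u: "Re u > 0" "norm u \<le> 1 + norm z"
      using z norm_triangle_ineq[of z 1] by (auto simp: u_def)
    note nz = Gamma_nonzero_Re_pos[of "of_nat N - s"] Gamma_nonzero_Re_pos[of "u + of_nat N"]
        Gamma_nonzero_Re_pos[of u]
    have "Gamma (u + s) / Gamma u = pochhammer u N * Beta (u + s) (of_nat N - s) / Gamma (of_nat N - s)"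
      using nz u s N by (simp add: pochhammer_Gamma Re_pos_not_nonpos_Ints Beta_def field_simps)
    hence "norm (Gamma (u + s) / Gamma u) = 
             norm (pochhammer u N) * (norm (Beta (u + s) (of_nat N - s)) / norm (Gamma (of_nat N - s)))"
      by (simp add: norm_mult norm_divide)
    also have "\<dots> \<le> fact N * exp (norm u + real N) * 
        (Beta (Re s) (real N - Re s) / norm (Gamma (of_nat N - s)))"
    proof (intro mult_mono norm_pochhammer_le_exp divide_right_mono)
      have "norm (incomplete_beta 1 (u + s) (of_nat N - s)) \<le> Beta (Re s) (real N - Re s)"
        using u s N by (intro norm_incomplete_beta_le) auto
      thus "norm (Beta (u + s) (of_nat N - s)) \<le> Beta (Re s) (real N - Re s)"
        using u s N by (simp add: incomplete_beta_1)
    qed auto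
    also have "\<dots> \<le> fact N * exp (1 + norm z + real N) * 
        (Beta (Re s) (real N - Re s) / norm (Gamma (of_nat N - s)))"
    proof (intro mult_right_mono mult_left_mono divide_nonneg_nonneg)
      show "Beta (Re s) (real N - Re s) \<ge> 0"
        using has_integral_beta_weight[of "Re s" "real N - Re s"] s N
        by (auto intro: has_integral_nonneg beta_weight_nonneg)
    qed (use u in auto)
    also have "\<dots> = C * exp (1 * norm z)"
      by (simp add: C_def exp_add mult_ac)
    finally show ?thesis by (simp add: u_def)
  qed
  thus ?thesis unfolding exp_bounded_iff by blast
qed

lemma exp_bounded_p_fun_snd:
  assumes "0 < x" "x < 1" "Re m > -1"
  shows "exp_bounded 1 (p_fun x m)"
proof -
  have "norm (incomplete_beta (1 - x) (n + 1) (m + 1) / Gamma (m + 1))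
          \<le> Beta 1 (Re m + 1) / norm (Gamma (m + 1))" if "Re n \<ge> 0" for n
    unfolding norm_divide using assms that by (intro divide_right_mono norm_incomplete_beta_le) auto
  with exp_bounded_Gamma_ratio[of "m + 1"] assms
  have "exp_bounded 1 (\<lambda>n. Gamma (n + 1 + (m + 1)) / Gamma (n + 1) *
           (incomplete_beta (1 - x) (n + 1) (m + 1) / Gamma (m + 1)))"
    by (intro exp_bounded_mult_bounded) auto
  also have "(\<lambda>n. Gamma (n + 1 + (m + 1)) / Gamma (n + 1) *
           (incomplete_beta (1 - x) (n + 1) (m + 1) / Gamma (m + 1))) = p_fun x m"
    by (simp add: p_fun_def fun_eq_iff add_ac mult_ac)
  finally show ?thesis .
qed

lemma exp_bounded_p_fun_fst:
  assumes "0 < x" "x < 1" "Re n > -1"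
  shows "exp_bounded 1 (\<lambda>m. p_fun x m n)"
proof -
  have "norm (incomplete_beta (1 - x) (n + 1) (m + 1) / Gamma (n + 1))
          \<le> Beta (Re n + 1) 1 / norm (Gamma (n + 1))" if "Re m \<ge> 0" for m
    unfolding norm_divide using assms that by (intro divide_right_mono norm_incomplete_beta_le) auto
  with exp_bounded_Gamma_ratio[of "n + 1"] assms
  have "exp_bounded 1 (\<lambda>m. Gamma (m + 1 + (n + 1)) / Gamma (m + 1) *
           (incomplete_beta (1 - x) (n + 1) (m + 1) / Gamma (n + 1)))"
    by (intro exp_bounded_mult_bounded) auto
  also have "(\<lambda>m. Gamma (m + 1 + (n + 1)) / Gamma (m + 1) *
           (incomplete_beta (1 - x) (n + 1) (m + 1) / Gamma (n + 1))) = (\<lambda>m. p_fun x m n)"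
    by (simp add: p_fun_def fun_eq_iff add_ac mult_ac)
  finally show ?thesis .
qed

section \<open>Existence and uniqueness\<close>

lemma pq_properties_p_fun_q_fun:
  assumes "0 < x" "x < 1"
  shows "pq_properties x (p_fun x) (q_fun x)"
  unfolding pq_properties_def
proof (intro conjI ballI allI bexI[of _ "1::real"])
  fix m n :: nat
  show "p_fun x (of_nat m) (of_nat n) =
     of_real ((1 - x) ^ (n + 1) * (\<Sum>k=0..m. pochhammer (of_nat n + 1) k / fact k * x ^ k))"
    using assms by (subst p_fun_of_nat) (auto simp: p_poly_def)
  show "q_fun x (of_nat m) (of_nat n) =
     of_real (x ^ (m + 1) * (\<Sum>k=0..n. pochhammer (of_nat m + 1) k / fact k * (1 - x) ^ k))"
    using assms unfolding q_fun_def by (subst p_fun_of_nat) (auto simp: p_poly_def)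
next
  show "analytic2_on (\<lambda>(m, n). p_fun x m n) (right_half_plane \<times> right_half_plane)"
    "analytic2_on (\<lambda>(m, n). q_fun x m n) (right_half_plane \<times> right_half_plane)"
    using assms by (auto intro!: analytic2_on_right_half_planeI
        complex_differentiable2_p_fun complex_differentiable2_q_fun)
next
  show "1 \<in> {0<..<pi}" using pi_gt3 by auto
  fix z assume "z \<in> right_half_plane"
  hence z: "Re z > -1" by (simp add: right_half_plane_def)
  show "exp_bounded 1 (\<lambda>n. p_fun x z n)" "exp_bounded 1 (\<lambda>m. p_fun x m z)"
    "exp_bounded 1 (\<lambda>n. q_fun x z n)" "exp_bounded 1 (\<lambda>m. q_fun x m z)"
    unfolding q_fun_def using assms z by (auto intro: exp_bounded_p_fun_fst exp_bounded_p_fun_snd)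
qed (use assms in \<open>auto simp: right_half_plane_def p_fun_add_q_fun\<close>)

text \<open>
  The difference has exponential type at most the larger of the two types, still below \<open>\<pi>\<close>. Carlson's
  theorem makes it vanish for \<open>Re z > 0\<close>, and the identity theorem extends this to \<open>Re z > -1\<close>.
\<close>

lemma eq_if_eq_on_naturals:
  assumes f: "f holomorphic_on right_half_plane" and g: "g holomorphic_on right_half_plane"
    and fc: "exp_bounded c f" "c < pi" and gd: "exp_bounded d g" "0 \<le> d" "d < pi"
    and eq: "\<And>n::nat. f (of_nat n) = g (of_nat n)"
    and w: "w \<in> right_half_plane"
  shows "f w = g w"
proof -
  define e where "e = max c d"
  obtain C where C: "\<And>z. Re z \<ge> 0 \<Longrightarrow> norm (f z) \<le> C * exp (c * norm z)"
    using fc unfolding exp_bounded_iff by blast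
  obtain D where D: "\<And>z. Re z \<ge> 0 \<Longrightarrow> norm (g z) \<le> D * exp (d * norm z)"
    using gd unfolding exp_bounded_iff by blast
  have sub: "{z. Re z > 0} \<subseteq> right_half_plane" by (auto simp: right_half_plane_def)
  have pos: "f z - g z = 0" if z: "Re z > 0" for z
  proof (rule Carlson[where f = "\<lambda>z. f z - g z" and w = z and c = e and C = "\<bar>C\<bar> + \<bar>D\<bar>"])
    show "(\<lambda>z. f z - g z) holomorphic_on {z. Re z > 0}"
      using f g sub by (auto intro!: holomorphic_intros intro: holomorphic_on_subset)
    show "norm (f z - g z) \<le> (\<bar>C\<bar> + \<bar>D\<bar>) * exp (e * norm z)" if "Re z > 0" for z
    proof -
      have "norm (f z - g z) \<le> norm (f z) + norm (g z)" by (rule norm_triangle_ineq4)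
      also have "\<dots> \<le> C * exp (c * norm z) + D * exp (d * norm z)"
        using C[of z] D[of z] that by auto
      also have "\<dots> \<le> \<bar>C\<bar> * exp (e * norm z) + \<bar>D\<bar> * exp (e * norm z)"
        by (intro add_mono mult_mono) (auto simp: e_def mult_right_mono)
      finally show ?thesis by (simp add: algebra_simps)
    qed
  qed (use fc gd eq z in \<open>auto simp: e_def\<close>)
  show ?thesis
  proof (rule analytic_continuation_open[of "{z. Re z > 0}" right_half_plane f g])
    show "{z. Re z > 0} \<noteq> {}" by (auto intro!: exI[of _ 1])
    show "connected right_half_plane" unfolding right_half_plane_def
      by (intro convex_connected convex_halfspace_Re_gt)
    show "f z = g z" if "z \<in> {z. Re z > 0}" for z using pos[of z] that by simp
  qed (use f g w sub in \<open>auto simp: open_halfspace_Re_gt right_half_plane_def\<close>)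
qed

text \<open>
  Only integers \<open>m\<close> can be treated in the first application of Carlson's theorem, since agreement at
  integer \<open>n\<close> is known only for those. Its result is the agreement at integer \<open>m\<close>, for every
  complex \<open>n\<close>, that the second application needs.
\<close>

lemma pq_properties_unique:
  assumes PQ: "pq_properties x P Q" and PQ': "pq_properties x P' Q'"
    and m: "m \<in> right_half_plane" and n: "n \<in> right_half_plane"
  shows "P m n = P' m n" "Q m n = Q' m n"
proof -
  have nat: "of_nat k \<in> right_half_plane" for k
    by (simp add: right_half_plane_def less_le_trans[of _ 0])
  from PQ obtain c where c: "0 < c" "c < pi"
    "\<And>m. m \<in> right_half_plane \<Longrightarrow> exp_bounded c (\<lambda>n. P m n)"
    "\<And>n. n \<in> right_half_plane \<Longrightarrow> exp_bounded c (\<lambda>m. P m n)"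
    unfolding pq_properties_def by auto
  from PQ' obtain d where d: "0 < d" "d < pi"
    "\<And>m. m \<in> right_half_plane \<Longrightarrow> exp_bounded d (\<lambda>n. P' m n)"
    "\<And>n. n \<in> right_half_plane \<Longrightarrow> exp_bounded d (\<lambda>m. P' m n)"
    unfolding pq_properties_def by auto
  have an: "analytic2_on (\<lambda>(m, n). P m n) (right_half_plane \<times> right_half_plane)"
    "analytic2_on (\<lambda>(m, n). P' m n) (right_half_plane \<times> right_half_plane)"
    using PQ PQ' by (auto simp: pq_properties_def)
  have nats: "P (of_nat j) (of_nat k) = P' (of_nat j) (of_nat k)" for j k
    using PQ PQ' unfolding pq_properties_def by metis
  have one: "P (of_nat j) n = P' (of_nat j) n" if "n \<in> right_half_plane" for j n
    by (rule eq_if_eq_on_naturals[of "P (of_nat j)" "P' (of_nat j)" c d])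
       (use analytic2_on_imp_holomorphic[OF an(1)] analytic2_on_imp_holomorphic[OF an(2)] 
            c d nats nat that in auto)
  show P: "P m n = P' m n"
    by (rule eq_if_eq_on_naturals[of "\<lambda>m. P m n" "\<lambda>m. P' m n" c d])
       (use analytic2_on_imp_holomorphic[OF an(1)] analytic2_on_imp_holomorphic[OF an(2)] 
            c d one m n in auto)
  have "P m n + Q m n = 1" "P' m n + Q' m n = 1"
    using PQ PQ' m n by (auto simp: pq_properties_def)
  thus "Q m n = Q' m n" using P by (metis add_left_cancel)
qed

theorem mainTheorem2:
  fixes x :: real
  assumes "0 < x" and "x < 1"
  shows "(\<forall>m n :: complex. Re m > -1 \<longrightarrow> Re n > -1 \<longrightarrow> p_fun x m n + q_fun x m n = 1) \<and>
    pq_properties x (p_fun x) (q_fun x) \<and>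
    (\<forall>P Q. pq_properties x P Q \<longrightarrow>
      (\<forall>m\<in>right_half_plane. \<forall>n\<in>right_half_plane.
         P m n = p_fun x m n \<and> Q m n = q_fun x m n))"
  using p_fun_add_q_fun[OF assms] pq_properties_p_fun_q_fun[OF assms] pq_properties_unique
  by blast

end
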